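(* Let $q=p^s$ be a power of an odd prime $p$, and let $r\ge 3$ be any odd number such that $\gcd(r,q)=1$. Let $d_r=\operatorname{ord}_r(q)$. If $d_r$ is odd, further assume $q\equiv 1\pmod 4$. Set $K:=v_2(q^{d_r}-1)$. Then: - For every nonnegative integer $n\le K$ and any irreducible factor $h_n$ of $\Phi_{2^nr}$ over $\mathbb{F}_q$, we have $\deg(h_n)=d_r$. - Furthermore, if $0<n<K$, then $h_n(x^2)$ decomposes into precisely two irreducible factors of degree $d_r$ over $\mathbb{F}_q$, which are irreducible factors of $\Phi_{2^{n+1}r}$. - On the other hand, for $n>K$ and any irreducible factor $h_K$ of $\Phi_{2^Kr}$ over $\mathbb{F}_q$, the polynomial $h_K(x^{2^{n-K}})$ is also irreducible over $\mathbb{F}_q$. Moreover, all irreducible factors of $\Phi_{2^nr}$ over $\mathbb{F}_q$ are obtained in this way.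
   Context: $\Phi_m$ denotes the $m$-th cyclotomic polynomial regarded over $\mathbb{F}_q$; $\operatorname{ord}_r(q)$ is the multiplicative order of $q$ modulo $r$; $v_2(k)$ is the exponent of the highest power of $2$ dividing $k$. Irreducible factors are taken monic. *)

theory Defs
  imports
    "HOL-Number_Theory.Number_Theory"
    "HOL-Computational_Algebra.Computational_Algebra"
    "HOL-Library.Cardinality"
begin

definition primitive_root_unity :: "nat \<Rightarrow> complex \<Rightarrow> bool" where
  "primitive_root_unity m z \<longleftrightarrow> m > 0 \<and> z ^ m = 1 \<and> (\<forall>k. 0 < k \<and> k < m \<longrightarrow> z ^ k \<noteq> 1)"

definition cyclotomic_complex :: "nat \<Rightarrow> complex poly" where
  "cyclotomic_complex m = (\<Prod>z | primitive_root_unity m z. [:- z, 1:])"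

text \<open>
  The cyclotomic polynomial over the integers is the unique integer polynomial whose image
  over the complex numbers is the product over the primitive roots of unity; it is shown to
  exist in \<open>cyclotomic_int\<close> below.
\<close>

definition cyclotomic_int :: "nat \<Rightarrow> int poly" where
  "cyclotomic_int m = (THE P. map_poly of_int P = cyclotomic_complex m)"

definition cyclotomic :: "nat \<Rightarrow> 'a::comm_ring_1 poly" where
  "cyclotomic m = map_poly of_int (cyclotomic_int m)"

definition monic_irreducible_factors :: "'a::field poly \<Rightarrow> 'a poly set" where
  "monic_irreducible_factors f = {h. lead_coeff h = 1 \<and> irreducible h \<and> h dvd f}"


lemma map_poly_of_int_add:
  "map_poly of_int (P + Q) = (map_poly of_int P + map_poly of_int Q :: 'a::comm_ring_1 poly)"
  by (intro poly_eqI) (simp add: coeff_map_poly)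

lemma map_poly_of_int_diff:
  "map_poly of_int (P - Q) = (map_poly of_int P - map_poly of_int Q :: 'a::comm_ring_1 poly)"
  by (intro poly_eqI) (simp add: coeff_map_poly)

lemma map_poly_of_int_mult:
  "map_poly of_int (P * Q) = (map_poly of_int P * map_poly of_int Q :: 'a::comm_ring_1 poly)"
  by (intro poly_eqI) (simp add: coeff_map_poly coeff_mult)

lemma map_poly_of_int_prod:
  "map_poly of_int (\<Prod>i\<in>A. P i) = (\<Prod>i\<in>A. map_poly of_int (P i) :: 'a::comm_ring_1 poly)"
  by (induction A rule: infinite_finite_induct) (simp_all add: map_poly_of_int_mult)

lemma map_poly_of_int_complex_inject:
  "map_poly of_int P = (map_poly of_int Q :: complex poly) \<longleftrightarrow> P = Q"
proof
  assume eq: "map_poly of_int P = (map_poly of_int Q :: complex poly)"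
  have "coeff P i = coeff Q i" for i
    using arg_cong[OF eq, of "\<lambda>R. coeff R i"] by (simp add: coeff_map_poly)
  thus "P = Q" by (rule poly_eqI)
qed simp

lemma degree_map_poly_of_int_complex:
  "degree (map_poly of_int P :: complex poly) = degree P"
  by (intro degree_map_poly) simp

lemma finite_primitive_root_unity: "finite {z. primitive_root_unity m z}"
proof (cases "m = 0")
  case False
  have "finite {z::complex. z ^ m = 1}"
    using False by (intro finite_roots_unity) simp
  thus ?thesis
    by (rule finite_subset[rotated]) (auto simp: primitive_root_unity_def)
qed (simp add: primitive_root_unity_def)

lemma lead_coeff_cyclotomic_complex: "lead_coeff (cyclotomic_complex m) = 1"
  by (simp add: cyclotomic_complex_def lead_coeff_prod)

lemma roots_unity_eq_UN_primitive:
  assumes "m > 0"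
  shows "{z::complex. z ^ m = 1} = (\<Union>d\<in>{d. d dvd m}. {z. primitive_root_unity d z})"
proof (intro equalityI subsetI)
  fix z :: complex assume "z \<in> {z. z ^ m = 1}"
  hence z: "z ^ m = 1" by simp
  define d where "d = (LEAST k. k > 0 \<and> z ^ k = 1)"
  have d: "d > 0" "z ^ d = 1"
    using LeastI[of "\<lambda>k. k > 0 \<and> z ^ k = 1" m] z assms by (auto simp: d_def)
  have least: "z ^ k \<noteq> 1" if "0 < k" "k < d" for k
    using not_less_Least[of k "\<lambda>k. k > 0 \<and> z ^ k = 1"] that by (auto simp: d_def)
  have "z ^ m = z ^ (d * (m div d) + m mod d)" by simp
  also have "\<dots> = z ^ (m mod d)" unfolding power_add power_mult d(2) by simp
  finally have "z ^ (m mod d) = 1" using z by simp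
  moreover have "m mod d < d" using d(1) by simp
  ultimately have "m mod d = 0" using least by blast
  hence "d dvd m" by auto
  moreover have "primitive_root_unity d z"
    using d least by (auto simp: primitive_root_unity_def)
  ultimately show "z \<in> (\<Union>d\<in>{d. d dvd m}. {z. primitive_root_unity d z})" by auto
next
  fix z assume "z \<in> (\<Union>d\<in>{d. d dvd m}. {z. primitive_root_unity d z})"
  then obtain d where "d dvd m" "z ^ d = 1" by (auto simp: primitive_root_unity_def)
  thus "z \<in> {z. z ^ m = 1}" by (auto simp: power_mult elim!: dvdE)
qed

lemma primitive_root_unity_unique:
  "primitive_root_unity d z \<Longrightarrow> primitive_root_unity e z \<Longrightarrow> d = e"
  unfolding primitive_root_unity_def by (metis linorder_neqE_nat)

lemma prod_cyclotomic_complex: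
  assumes "m > 0"
  shows "(\<Prod>d | d dvd m. cyclotomic_complex d) = monom 1 m - 1"
proof -
  let ?p = "monom 1 m - 1 :: complex poly"
  have poly_p: "poly ?p z = z ^ m - 1" for z by (simp add: poly_monom)
  have "rsquarefree ?p"
    unfolding rsquarefree_roots
  proof (intro allI notI, elim conjE)
    fix z assume "poly ?p z = 0" "poly (pderiv ?p) z = 0"
    hence "z ^ m = 1" "of_nat m * z ^ (m - 1) = 0"
      by (simp_all add: poly_p pderiv_diff pderiv_monom poly_monom)
    thus False using assms by (auto simp: power_0_left split: if_splits)
  qed
  hence "smult (lead_coeff ?p) (\<Prod>z | poly ?p z = 0. [:- z, 1:]) = ?p"
    by (rule complex_poly_decompose_rsquarefree)
  moreover have "degree ?p = m"
  proof -
    have "degree ?p = degree (monom 1 m :: complex poly)"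
      using assms by (subst diff_conv_add_uminus, subst degree_add_eq_left) (auto simp: degree_monom_eq)
    thus ?thesis by (simp add: degree_monom_eq)
  qed
  hence "lead_coeff ?p = 1" using assms by simp
  ultimately have "?p = (\<Prod>z | z ^ m = 1. [:- z, 1:])" by (simp add: poly_monom)
  also have "\<dots> = (\<Prod>d | d dvd m. cyclotomic_complex d)"
    unfolding cyclotomic_complex_def roots_unity_eq_UN_primitive[OF assms]
    using assms
    by (intro prod.UNION_disjoint)
       (auto simp: finite_primitive_root_unity dest: primitive_root_unity_unique)
  finally show ?thesis ..
qed

lemma ex_cyclotomic_int: "\<exists>P. map_poly of_int P = cyclotomic_complex m"
proof (induction m rule: less_induct)
  case (less m)
  show ?case
  proof (cases "m = 0")
    case True
    thus ?thesis
      by (intro exI[of _ 1]) (simp add: cyclotomic_complex_def primitive_root_unity_def)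
  next
    case False
    define D where "D = {d. d dvd m \<and> d < m}"
    have D: "{d. d dvd m} = insert m D" "finite D" "m \<notin> D"
      using False by (auto simp: D_def dest: dvd_imp_le)
    from less have "\<forall>d\<in>D. \<exists>P. map_poly of_int P = cyclotomic_complex d"
      by (auto simp: D_def)
    then obtain P where P: "map_poly of_int (P d) = cyclotomic_complex d" if "d \<in> D" for d
      by metis
    define Q where "Q = (\<Prod>d\<in>D. P d)"
    let ?c = "map_poly of_int :: int poly \<Rightarrow> complex poly"
    have Q: "?c Q = (\<Prod>d\<in>D. cyclotomic_complex d)"
      by (simp add: Q_def map_poly_of_int_prod P)
    have "lead_coeff (?c Q) = 1"
      unfolding Q lead_coeff_prod by (simp add: lead_coeff_cyclotomic_complex)
    hence lQ: "lead_coeff Q = 1"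
      by (simp add: degree_map_poly_of_int_complex coeff_map_poly)
    hence Q0: "Q \<noteq> 0" by auto
    obtain A R where AR: "pseudo_divmod (monom 1 m - 1) Q = (A, R)" by fastforce
    from pseudo_divmod[OF Q0 AR] lQ
    have eq: "monom 1 m - 1 = Q * A + R" and deg: "R = 0 \<or> degree R < degree Q" by auto
    have "cyclotomic_complex m * ?c Q = monom 1 m - 1"
      using prod_cyclotomic_complex[of m] False D Q by simp
    also have "\<dots> = ?c (monom 1 m - 1)" by (simp add: map_poly_of_int_diff map_poly_monom)
    also have "\<dots> = ?c Q * ?c A + ?c R"
      by (simp add: eq map_poly_of_int_add map_poly_of_int_mult)
    finally have R: "?c R = ?c Q * (cyclotomic_complex m - ?c A)" by (simp add: algebra_simps)
    have "?c R = 0"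
    proof (rule ccontr)
      assume nz: "?c R \<noteq> 0"
      hence "degree (?c Q) \<le> degree (?c R)" using R by (intro dvd_imp_degree_le) auto
      moreover have "R \<noteq> 0" using nz by auto
      ultimately show False using deg by (simp add: degree_map_poly_of_int_complex)
    qed
    moreover have "?c Q \<noteq> 0"
      using \<open>lead_coeff (?c Q) = 1\<close> by auto
    ultimately have "cyclotomic_complex m = ?c A" using R by simp
    thus ?thesis by metis
  qed
qed

theorem cyclotomic_int: "map_poly of_int (cyclotomic_int m) = cyclotomic_complex m"
proof -
  have "\<exists>!P. map_poly of_int P = cyclotomic_complex m"
    using ex_cyclotomic_int[of m] by (metis map_poly_of_int_complex_inject)
  thus ?thesis unfolding cyclotomic_int_def by (rule theI')
qed

theorem prod_cyclotomic:
  assumes "m > 0"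
  shows "(\<Prod>d | d dvd m. cyclotomic d) = (monom 1 m - 1 :: 'a::comm_ring_1 poly)"
proof -
  have "map_poly of_int (\<Prod>d | d dvd m. cyclotomic_int d) = (monom 1 m - 1 :: complex poly)"
    by (simp add: map_poly_of_int_prod cyclotomic_int prod_cyclotomic_complex[OF assms])
  also have "\<dots> = map_poly of_int (monom 1 m - 1)"
    by (simp add: map_poly_of_int_diff map_poly_monom)
  finally have "(\<Prod>d | d dvd m. cyclotomic_int d) = monom 1 m - 1"
    by (simp only: map_poly_of_int_complex_inject)
  from arg_cong[OF this, of "map_poly of_int :: int poly \<Rightarrow> 'a poly"] show ?thesis
    by (simp add: map_poly_of_int_prod map_poly_of_int_diff map_poly_monom cyclotomic_def)
qed

end

(*
  Everything rests on the fact that an irreducible factor f of the m-th cyclotomic polynomial over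
  a field with q elements has degree D = ord_m(q) when gcd(m, q) = 1. As x^m - 1 is squarefree, x
  has order exactly m modulo f. Fermat's theorem in F[x]/(f) gives m | q^D - 1, so ord_m(q) | D.
  Conversely, with N = q^ord_m(q) we have x^N = x modulo f, hence g^N = g(x^N) = g modulo f for
  every polynomial g, and counting the roots of Y^N - Y in F[x]/(f) gives q^D <= N.

  Lifting the exponent at 2 shows ord_{2^n r}(q) = d * 2^max(0, n - K). Moreover
  Phi_{2m}(x) = Phi_m(x^2) for even m. So h(x^2), respectively h(x^(2^(n-K))), divides
  Phi_{2^(n+1) r}, respectively Phi_{2^n r}, and comparing degrees decides how it factors.
*)
theory Submission
  imports Defs
begin

section \<open>Arithmetic in F[x]/(f) through divisibility by f: roots, counting, Fermat\<close>

text \<open>Modulo a prime element the ring is an integral domain, so roots can be split off one at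
  a time. The quotient ring is never formed: congruence modulo \<open>f\<close> replaces equality,
  \<open>S\<close> holds representatives of distinct classes, and the condition on the leading
  coefficient keeps the degree from dropping modulo \<open>f\<close>.\<close>

lemma card_roots_mod_prime_le_degree:
  fixes f :: "'r::comm_ring_1"
  assumes "prime_elem f" "\<not> f dvd lead_coeff P" "finite S"
    and "\<And>s. s \<in> S \<Longrightarrow> f dvd poly P s"
    and "\<And>s t. s \<in> S \<Longrightarrow> t \<in> S \<Longrightarrow> f dvd s - t \<Longrightarrow> s = t"
  shows "card S \<le> degree P"
  using assms(2-)
proof (induction "degree P" arbitrary: P S)
  case 0
  then obtain c where "P = [:c:]" by (metis degree_eq_zeroE)
  with 0 have "S = {}" by auto
  thus ?case by simp
next
  case (Suc n)
  show ?case
  proof (cases "S = {}")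
    case False
    then obtain s where s: "s \<in> S" by auto
    define Q where "Q = synthetic_div P s"
    have P: "P = [:-s, 1:] * Q + [:poly P s:]"
      unfolding Q_def by (rule synthetic_div_correct'[symmetric])
    have deg: "degree Q = n"
      using Suc(2) by (simp add: Q_def degree_synthetic_div)
    \<comment> \<open>Comparing top coefficients in the synthetic division identity shows that
      \<open>Q\<close> inherits the leading coefficient of \<open>P\<close>, so the hypothesis on it
      survives the induction.\<close>
    have "coeff P (Suc n) + s * coeff Q (Suc n) = coeff Q n"
      using arg_cong[OF synthetic_div_correct[of P s], of "\<lambda>p. coeff p (Suc n)"]
      by (simp add: Q_def)
    moreover have "coeff Q (Suc n) = 0" using deg by (intro coeff_eq_0) simp
    ultimately have "lead_coeff Q = lead_coeff P" using deg Suc(2) by simp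
    hence lc: "\<not> f dvd lead_coeff Q" using Suc.prems(1) by simp
    have "card (S - {s}) \<le> degree Q"
    proof (rule Suc(1))
      fix t assume t: "t \<in> S - {s}"
      have "poly P t = (t - s) * poly Q t + poly P s"
        by (subst P) (simp add: algebra_simps)
      hence "f dvd (t - s) * poly Q t"
        using Suc.prems(3)[of t] Suc.prems(3)[OF s] t by (simp add: dvd_add_left_iff)
      moreover have "\<not> f dvd t - s" using Suc.prems(4)[of t s] s t by auto
      ultimately show "f dvd poly Q t"
        using \<open>prime_elem f\<close> by (simp add: prime_elem_dvd_mult_iff)
    qed (use deg lc Suc.prems in auto)
    thus ?thesis using deg Suc(2) Suc.prems(2) s by simp
  qed simp
qed

text \<open>These polynomials are the standard representatives modulo a polynomial of degree
  \<open>D\<close>; they correspond to their coefficient lists padded to length \<open>D\<close>.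
  For \<open>D = 0\<close> the set would be empty, as even the zero polynomial has degree 0, while
  the power would be 1.\<close>

lemma card_degree_less:
  fixes D :: nat
  assumes "D > 0"
  shows "card {p :: 'a::{comm_ring_1,finite} poly. degree p < D} = CARD('a) ^ D" (is ?A)
    and "finite {p :: 'a poly. degree p < D}" (is ?B)
proof -
  let ?L = "{xs :: 'a list. set xs \<subseteq> UNIV \<and> length xs = D}"
  have "bij_betw Poly ?L {p. degree p < D}"
  proof (rule bij_betwI[where g = "\<lambda>p. map (coeff p) [0..<D]"])
    show "Poly \<in> ?L \<rightarrow> {p. degree p < D}"
    proof
      fix xs :: "'a list" assume "xs \<in> ?L"
      hence "coeff (Poly xs) i = 0" if "i > D - 1" for i
        using that by (simp add: nth_default_def)
      hence "degree (Poly xs) \<le> D - 1" by (intro degree_le) auto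
      thus "Poly xs \<in> {p. degree p < D}" using assms by simp
    qed
    show "(\<lambda>p. map (coeff p) [0..<D]) \<in> {p. degree p < D} \<rightarrow> ?L" by auto
    show "map (coeff (Poly xs)) [0..<D] = xs" if "xs \<in> ?L" for xs
      using that by (auto intro!: nth_equalityI simp: nth_default_def)
    show "Poly (map (coeff p) [0..<D]) = p" if "p \<in> {p. degree p < D}" for p
      using that by (auto intro!: poly_eqI simp: nth_default_def coeff_eq_0)
  qed
  thus ?A ?B
    using card_lists_length_eq[of "UNIV :: 'a set" D] finite_lists_length_eq[of "UNIV :: 'a set" D]
    by (auto dest: bij_betw_same_card simp: bij_betw_finite)
qed

text \<open>Multiplication by \<open>g\<close> followed by reduction permutes the set
  \<open>T\<close> of nonzero residues modulo \<open>f\<close>. Multiplying all residues together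
  before and after the permutation, and cancelling the product of \<open>T\<close>, which is prime
  to \<open>f\<close>, leaves the claim.\<close>

lemma prime_elem_poly_fermat:
  fixes f g :: "'a::{field,finite} poly"
  assumes "prime_elem f" "\<not> f dvd g"
  shows "f dvd g ^ (CARD('a) ^ degree f - 1) - 1"
proof -
  define T where "T = {p :: 'a poly. degree p < degree f} - {0}"
  have f0: "f \<noteq> 0" using assms by auto
  have "degree f > 0"
    using assms(1) f0 by (auto simp: prime_elem_def is_unit_iff_degree intro!: Nat.gr0I)
  note card = card_degree_less[OF this, where 'a = 'a]
  have [simp]: "finite T" using card by (simp add: T_def)
  have cT: "card T = CARD('a) ^ degree f - 1"
    using card \<open>degree f > 0\<close> by (simp add: T_def)
  have nd: "\<not> f dvd p" if "p \<in> T" for p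
    using that dvd_imp_degree_le[of f p] by (auto simp: T_def)
  have nd': "\<not> f dvd g * p" if "p \<in> T" for p
    using nd[OF that] assms by (simp add: prime_elem_dvd_mult_iff)
  define \<phi> where "\<phi> p = (g * p) mod f" for p
  have "inj_on \<phi> T"
  proof (rule inj_onI)
    fix p r assume pr: "p \<in> T" "r \<in> T" "\<phi> p = \<phi> r"
    hence "f dvd g * p - g * r" by (simp add: \<phi>_def mod_eq_dvd_iff)
    hence "f dvd g * (p - r)" by (simp add: algebra_simps)
    hence dvd: "f dvd p - r" using assms by (simp add: prime_elem_dvd_mult_iff)
    have "degree (p - r) < degree f" using pr by (auto simp: T_def intro: degree_diff_less)
    thus "p = r" using dvd dvd_imp_degree_le[of f "p - r"] by auto
  qed
  moreover have "\<phi> ` T \<subseteq> T"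
  proof
    fix y assume "y \<in> \<phi> ` T"
    then obtain p where p: "p \<in> T" "y = \<phi> p" by auto
    have "y \<noteq> 0" using nd'[OF p(1)] p(2) by (auto simp: \<phi>_def mod_eq_0_iff_dvd)
    moreover have "degree y < degree f"
      using degree_mod_less[OF f0, of "g * p"] \<open>degree f > 0\<close> p(2) by (auto simp: \<phi>_def)
    ultimately show "y \<in> T" by (simp add: T_def)
  qed
  ultimately have bij: "bij_betw \<phi> T T"
    by (simp add: bij_betw_def endo_inj_surj)
  have "(\<Prod>p\<in>T. g * p) mod f = (\<Prod>p\<in>T. \<phi> p) mod f"
    by (simp add: \<phi>_def mod_prod_eq)
  also have "(\<Prod>p\<in>T. \<phi> p) = \<Prod>T"
    using prod.reindex_bij_betw[OF bij, of "\<lambda>x. x"] by simp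
  finally have "f dvd g ^ card T * \<Prod>T - \<Prod>T"
    by (simp add: prod.distrib mod_eq_dvd_iff)
  hence "f dvd (g ^ card T - 1) * \<Prod>T" by (simp add: algebra_simps)
  moreover have "\<not> f dvd \<Prod>T"
    using \<open>finite T\<close> nd
  proof (induction T)
    case empty
    show ?case using assms(1) by (simp add: prime_elem_def)
  next
    case (insert p T)
    thus ?case using assms(1) by (simp add: prime_elem_dvd_mult_iff)
  qed
  ultimately show ?thesis
    using assms(1) cT by (simp add: prime_elem_dvd_mult_iff)
qed

section \<open>Frobenius on polynomials over a finite field\<close>

text \<open>The same permutation argument, with multiplication by \<open>c\<close> on the nonzero
  field elements.\<close>

lemma finite_field_power_card:
  fixes c :: "'a::{field,finite}"
  shows "c ^ CARD('a) = c"
proof (cases "c = 0")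
  case False
  have "(\<Prod>y\<in>UNIV-{0}. c * y) = (\<Prod>y\<in>UNIV-{0}. y)"
    by (rule prod.reindex_bij_witness[of _ "\<lambda>y. y / c" "\<lambda>y. c * y"]) (use False in auto)
  hence "c ^ (CARD('a) - 1) = 1" by (simp add: prod.distrib)
  thus ?thesis using power_minus_mult[of "CARD('a)" c] by simp
qed (simp add: power_0_left)

lemma CHAR_finite_field:
  assumes "prime p" "CARD('a::{field,finite}) = p ^ s"
  shows "CHAR('a) = p"
proof -
  have "prime CHAR('a)" using finite_imp_CHAR_pos[where ?'a = 'a] prime_CHAR_semidom[where ?'a = 'a] by simp
  moreover have "CHAR('a) dvd p ^ s" using CHAR_dvd_CARD[where ?'a = 'a] assms by simp
  ultimately show ?thesis using assms by (metis prime_dvd_power primes_dvd_imp_eq)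
qed

text \<open>\<open>N\<close> is a power of the characteristic, so taking \<open>N\<close>-th powers
  is additive; it also fixes every coefficient, as \<open>N\<close> is a power of the field size.
  Hence only the variable changes, from x to x^N.\<close>

lemma frobenius_poly:
  fixes g :: "'a::{field,finite} poly"
  assumes "prime p" "CARD('a) = p ^ s" "N = CARD('a) ^ t"
  shows "g ^ N = pcompose g (monom 1 N)"
proof (induction g)
  case 0
  thus ?case using assms by (simp add: power_0_left)
next
  case (pCons a g)
  have N: "N = CHAR('a) ^ (s * t)"
    using assms CHAR_finite_field[OF assms(1,2)] by (simp add: power_mult)
  have "a ^ CARD('a) ^ t = a"
    by (induction t) (simp_all add: power_mult finite_field_power_card)
  hence aN: "a ^ N = a" using assms by simp
  have "pCons a g = [:a:] + [:0, 1:] * g" by simp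
  also have "\<dots> ^ N = [:a:] ^ N + [:0, 1:] ^ N * g ^ N"
    using freshmans_dream'[where 'a = "'a poly", of N "s * t" "[:a:]" "[:0, 1:] * g"] N assms(1)
      CHAR_finite_field[OF assms(1,2)]
    by (simp only: semiring_char_poly power_mult_distrib)
  also have "\<dots> = pcompose (pCons a g) (monom 1 N)"
    by (simp add: pCons.IH pcompose_pCons poly_const_pow aN monom_altdef)
  finally show ?case .
qed

text \<open>Taken at x^N and x, this carries the congruence x^N = x modulo f over to g(x^N) = g for
  every polynomial g.\<close>

lemma diff_dvd_pcompose_diff:
  fixes g a b :: "'a::comm_ring_1 poly"
  shows "a - b dvd pcompose g a - pcompose g b"
proof (induction g)
  case (pCons c g)
  have "pcompose (pCons c g) a - pcompose (pCons c g) b =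
      a * (pcompose g a - pcompose g b) + (a - b) * pcompose g b"
    by (simp add: pcompose_pCons algebra_simps)
  thus ?case using pCons by (simp only: dvd_add dvd_mult dvd_triv_left)
qed simp

section \<open>Lifting the exponent at 2\<close>

text \<open>Induction on \<open>j\<close> with \<open>Q\<close> and \<open>K\<close> varying: for
  even \<open>u\<close>, passing to \<open>Q ^ 2\<close> raises \<open>K\<close> by one and halves
  \<open>u\<close>; for odd \<open>u\<close>, the congruence already fails modulo
  \<open>2 ^ (K + 1)\<close>.\<close>

lemma two_power_cong_iff:
  fixes Q c K :: nat
  assumes "Q = 1 + 2 ^ K * c" "odd c" "K \<ge> 2"
  shows "[Q ^ u = 1] (mod 2 ^ (K + j)) \<longleftrightarrow> 2 ^ j dvd u"
  using assms
proof (induction j arbitrary: Q c K u)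
  case 0
  have "[1 + 2 ^ K * c = 1 + 0] (mod 2 ^ K)" by (intro cong_add) (auto simp: cong_def)
  from cong_pow[OF this, of u] 0 show ?case by simp
next
  case (Suc j)
  \<comment> \<open>This is the cofactor of \<open>2 ^ (K + 1)\<close> in \<open>Q ^ 2 - 1\<close>.
    It is odd because \<open>K \<ge> 2\<close> makes \<open>2 ^ (K - 1)\<close> even.\<close>
  define c' where "c' = c * (1 + 2 ^ (K - 1) * c)"
  have "odd c'" using Suc.prems by (simp add: c'_def)
  have "(2::nat) ^ K = 2 * 2 ^ (K - 1)" using Suc.prems by (cases K) auto
  hence Q2: "Q ^ 2 = 1 + 2 ^ (K + 1) * c'"
    by (simp add: Suc.prems(1) c'_def power2_eq_square algebra_simps)
  show ?case
  proof (cases "even u")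
    case True
    then obtain v where u: "u = 2 * v" by auto
    have "[Q ^ u = 1] (mod 2 ^ (K + Suc j)) \<longleftrightarrow> [(Q ^ 2) ^ v = 1] (mod 2 ^ ((K + 1) + j))"
      by (simp add: u power_mult)
    also have "\<dots> \<longleftrightarrow> 2 ^ j dvd v"
      using Q2 \<open>odd c'\<close> Suc.prems by (intro Suc.IH) auto
    finally show ?thesis by (simp add: u)
  next
    case False
    then obtain v where u: "u = 2 * v + 1" by (auto elim: oddE)
    \<comment> \<open>Since the square of \<open>Q\<close> is 1 modulo \<open>2 ^ (K + 1)\<close>,
      every odd power of \<open>Q\<close> is congruent to \<open>Q\<close>, which is not 1 there
      because \<open>c\<close> is odd.\<close>
    have "[Q ^ 2 = 1 + 0] (mod 2 ^ (K + 1))"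
      unfolding Q2 by (intro cong_add) (auto simp: cong_def)
    hence "[(Q ^ 2) ^ v * Q = 1 ^ v * Q] (mod 2 ^ (K + 1))" by (intro cong_mult cong_pow) auto
    hence Qu: "[Q ^ u = Q] (mod 2 ^ (K + 1))" by (simp add: u mult.commute flip: power_mult)
    have "\<not> [Q ^ u = 1] (mod 2 ^ (K + Suc j))"
    proof
      assume "[Q ^ u = 1] (mod 2 ^ (K + Suc j))"
      hence "[Q ^ u = 1] (mod 2 ^ (K + 1))"
        by (rule cong_dvd_modulus_nat) (simp add: le_imp_power_dvd)
      hence "[Q = 1] (mod 2 ^ (K + 1))" using Qu cong_sym cong_trans by blast
      hence "2 ^ (K + 1) dvd 2 ^ K * c" by (simp add: Suc.prems(1) cong_altdef_nat)
      thus False using \<open>odd c\<close> by simp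
    qed
    thus ?thesis using False by auto
  qed
qed

section \<open>The order of x modulo a cyclotomic factor, and the degree of that factor\<close>

text \<open>One step of Euclid's algorithm on exponents; it makes the least positive exponent divide
  all others.\<close>

lemma dvd_power_mod_diff_1:
  fixes f x :: "'r::comm_ring_1"
  assumes "f dvd x ^ a - 1" "f dvd x ^ b - 1"
  shows "f dvd x ^ (a mod b) - 1"
proof -
  have "x ^ b - 1 dvd x ^ (b * (a div b)) - 1" by (simp add: power_mult power_diff_1_eq)
  with assms(2) have "f dvd x ^ (b * (a div b)) - 1" by (rule dvd_trans)
  hence "f dvd x ^ (a mod b) * (x ^ (b * (a div b)) - 1)" by simp
  also have "x ^ (a mod b) * (x ^ (b * (a div b)) - 1) = (x ^ a - 1) - (x ^ (a mod b) - 1)"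
    by (simp add: algebra_simps flip: power_add)
  finally show ?thesis using assms(1) by (metis dvd_diff_right_iff)
qed

lemma lead_coeff_cyclotomic: "lead_coeff (cyclotomic m :: 'a::comm_ring_1 poly) = 1"
proof -
  have lc: "lead_coeff (cyclotomic_int m) = 1"
    using lead_coeff_cyclotomic_complex[of m]
    by (simp add: degree_map_poly_of_int_complex coeff_map_poly flip: cyclotomic_int)
  hence "degree (cyclotomic m :: 'a poly) = degree (cyclotomic_int m)"
    unfolding cyclotomic_def by (intro map_poly_degree_eq) auto
  thus ?thesis using lc by (simp add: cyclotomic_def coeff_map_poly)
qed

lemma cyclotomic_dvd:
  assumes "m > 0"
  shows "cyclotomic m dvd ([:0, 1:] ^ m - 1 :: 'a::comm_ring_1 poly)"
proof -
  have "cyclotomic m dvd (\<Prod>d | d dvd m. cyclotomic d :: 'a poly)"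
    using assms by (intro dvd_prodI) auto
  thus ?thesis using assms by (simp add: prod_cyclotomic monom_altdef)
qed

text \<open>In the factorization of x^m - 1 over the divisors of \<open>m\<close>, the index
  \<open>m\<close> and the divisors of \<open>e\<close> are distinct, because
  \<open>e < m\<close>.\<close>

lemma cyclotomic_mult_dvd:
  assumes "m > 0" "e dvd m" "e < m"
  shows "cyclotomic m * ([:0, 1:] ^ e - 1) dvd ([:0, 1:] ^ m - 1 :: 'a::comm_ring_1 poly)"
proof -
  have "e > 0" using assms by (auto intro!: Nat.gr0I)
  have "cyclotomic m * (\<Prod>d | d dvd e. cyclotomic d) = (\<Prod>d\<in>insert m {d. d dvd e}. cyclotomic d :: 'a poly)"
    using assms \<open>e > 0\<close> by (subst prod.insert) (auto dest: dvd_imp_le)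
  also have "\<dots> dvd (\<Prod>d | d dvd m. cyclotomic d)"
    using assms by (intro prod_dvd_prod_subset) (auto intro: dvd_trans)
  finally show ?thesis
    using assms \<open>e > 0\<close> by (simp add: prod_cyclotomic monom_altdef)
qed

text \<open>A squared factor would divide the derivative m x^(m-1) as well, hence x^m since
  \<open>m\<close> is invertible, hence 1.\<close>

lemma not_square_dvd_X_power_minus_one:
  fixes f :: "'a::field poly"
  assumes "prime_elem f" "of_nat m \<noteq> (0 :: 'a)"
  shows "\<not> f * f dvd [:0, 1:] ^ m - 1"
proof
  assume "f * f dvd [:0, 1:] ^ m - 1"
  then obtain g where g: "monom 1 m - 1 = f * f * g" by (auto simp: monom_altdef)
  have "m > 0" using assms(2) by (auto intro!: Nat.gr0I)
  have "monom (of_nat m) (m - 1) = pderiv (monom 1 m - 1 :: 'a poly)"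
    by (simp add: pderiv_diff pderiv_monom)
  also have "\<dots> = f * (2 * pderiv f * g + f * pderiv g)"
    by (simp add: g pderiv_mult algebra_simps)
  \<comment> \<open>The second factor is x/m: it turns the derivative into x^m, which can be
    compared with x^m - 1.\<close>
  finally have "f dvd monom (of_nat m) (m - 1) * monom (inverse (of_nat m)) 1" by simp
  hence "f dvd monom 1 m" using assms \<open>m > 0\<close> by (simp add: mult_monom)
  moreover have "f dvd monom 1 m - 1" by (simp add: g)
  ultimately have "f dvd monom 1 m - (monom 1 m - 1)" by (rule dvd_diff)
  thus False using assms(1) by (simp add: prime_elem_def)
qed

text \<open>Let \<open>e\<close> be the order of x modulo \<open>f\<close>. It divides
  \<open>m\<close>; were it smaller, \<open>f\<close> would divide both \<open>cyclotomic m\<close>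
  and x^e - 1, so the square of \<open>f\<close> would divide x^m - 1.\<close>

lemma dvd_X_power_minus_one_iff:
  fixes f :: "'a::field poly"
  assumes "prime_elem f" "f dvd cyclotomic m" "of_nat m \<noteq> (0 :: 'a)"
  shows "f dvd [:0, 1:] ^ k - 1 \<longleftrightarrow> m dvd k"
proof -
  have "m > 0" using assms(3) by (auto intro!: Nat.gr0I)
  have m: "f dvd [:0, 1:] ^ m - 1"
    using assms(2) cyclotomic_dvd[OF \<open>m > 0\<close>] by (rule dvd_trans)
  define P where "P e \<longleftrightarrow> e > 0 \<and> f dvd [:0, 1:] ^ e - 1" for e
  define e where "e = (LEAST e. P e)"
  have "P m" using m \<open>m > 0\<close> by (simp add: P_def)
  hence "P e" "e \<le> m" unfolding e_def by (auto intro: LeastI Least_le)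
  have e: "e dvd k" if "f dvd [:0, 1:] ^ k - 1" for k
  proof -
    have "f dvd [:0, 1:] ^ (k mod e) - 1"
      using \<open>P e\<close> that by (intro dvd_power_mod_diff_1) (auto simp: P_def)
    moreover have "\<not> P (k mod e)"
      using not_less_Least[of "k mod e" P, folded e_def] \<open>P e\<close> by (simp add: P_def)
    ultimately show ?thesis by (auto simp: P_def)
  qed
  have "e = m"
  proof (rule ccontr)
    assume "e \<noteq> m"
    hence "cyclotomic m * ([:0, 1:] ^ e - 1) dvd ([:0, 1:] ^ m - 1 :: 'a poly)"
      using \<open>e \<le> m\<close> e[OF m] \<open>m > 0\<close> by (intro cyclotomic_mult_dvd) auto
    moreover have "f * f dvd cyclotomic m * ([:0, 1:] ^ e - 1)"
      using assms(2) \<open>P e\<close> by (intro mult_dvd_mono) (auto simp: P_def)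
    ultimately show False
      using not_square_dvd_X_power_minus_one[OF assms(1,3)] dvd_trans by blast
  qed
  moreover have "f dvd [:0, 1:] ^ k - 1" if "m dvd k"
  proof -
    obtain j where "k = m * j" using \<open>m dvd k\<close> by (rule dvdE)
    hence "[:0, 1:] ^ m - 1 dvd ([:0, 1:] ^ k - 1 :: 'a poly)"
      by (simp add: power_mult power_diff_1_eq)
    with m show ?thesis by (rule dvd_trans)
  qed
  ultimately show ?thesis using e by blast
qed

theorem degree_irreducible_factor_cyclotomic:
  fixes f :: "'a::{field,finite} poly"
  assumes "prime p" "CARD('a) = p ^ s" "coprime m CARD('a)"
    and "irreducible f" "f dvd cyclotomic m"
  shows "degree f = ord m CARD('a)"
proof -
  define q where "q = CARD('a)"
  define t where "t = ord m q"
  define N where "N = q ^ t"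
  have "q > 1" using finite_UNIV_card_ge_0[where ?'a = 'a] card_mono[of UNIV "{0, 1 :: 'a}"]
    by (simp add: q_def)
  have "t > 0" using assms(3) by (simp add: t_def q_def)
  have "s > 0" using \<open>q > 1\<close> assms(2) by (auto simp: q_def intro!: Nat.gr0I)
  \<comment> \<open>Coprimality to the field size keeps \<open>p\<close> from dividing
    \<open>m\<close>, so \<open>m\<close> is nonzero in the field.\<close>
  hence "\<not> p dvd m" using assms(1-3) by (auto simp: prime_imp_coprime coprime_commute not_prime_unit
    dest!: coprime_common_divisor_nat[of m _ p])
  hence m0: "of_nat m \<noteq> (0 :: 'a)"
    by (simp add: of_nat_eq_0_iff_char_dvd CHAR_finite_field[OF assms(1,2)])
  hence "m > 0" by (auto intro!: Nat.gr0I)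
  have prime: "prime_elem f" using assms(4) by (rule field_poly_irreducible_imp_prime)
  note dvd_iff = dvd_X_power_minus_one_iff[OF prime assms(5) m0]
  have "degree f > 0"
    using assms(4) by (auto simp: irreducible_def is_unit_iff_degree intro!: Nat.gr0I)
  note card = card_degree_less[OF this, where 'a = 'a]
  have "[q ^ t = 1] (mod m)" unfolding t_def by (rule ord)
  hence "f dvd [:0, 1:] ^ (N - 1) - 1"
    using \<open>q > 1\<close> by (simp add: dvd_iff N_def cong_altdef_nat)
  hence "f dvd [:0, 1:] * ([:0, 1:] ^ (N - 1) - 1)" by (rule dvd_mult)
  also have "[:0, 1:] * ([:0, 1:] ^ (N - 1) - 1) = ([:0, 1:] ^ N - [:0, 1:] :: 'a poly)"
    using \<open>q > 1\<close> by (simp add: N_def right_diff_distrib power_eq_if[of _ "q ^ t"])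
  finally have fX: "f dvd monom 1 N - [:0, 1:]" by (simp add: monom_altdef)
  have root: "f dvd g ^ N - g" for g
    using dvd_trans[OF fX diff_dvd_pcompose_diff[of _ _ g]]
    by (simp add: frobenius_poly[OF assms(1,2) N_def[unfolded q_def]])
  \<comment> \<open>This is Y^N - Y over F[x]. Every polynomial is a root modulo \<open>f\<close>,
    and those of degree below \<open>degree f\<close> are pairwise incongruent, so
    \<open>q ^ degree f \<le> q ^ t\<close>.\<close>
  define P :: "'a poly poly" where "P = monom 1 N - monom 1 1"
  have "N > 1" using \<open>q > 1\<close> \<open>t > 0\<close> unfolding N_def by (rule one_less_power)
  hence "degree P = degree (monom 1 N :: 'a poly poly)"
    unfolding P_def diff_conv_add_uminus by (intro degree_add_eq_left) (simp add: degree_monom_eq)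
  hence P: "degree P = N" "lead_coeff P = 1"
    using \<open>N > 1\<close> by (simp_all add: degree_monom_eq P_def)
  have "card {g :: 'a poly. degree g < degree f} \<le> degree P"
  proof (rule card_roots_mod_prime_le_degree[OF prime])
    show "\<not> f dvd lead_coeff P" using prime P by (simp add: prime_elem_def)
    show "f dvd poly P g" for g using root[of g] by (simp add: P_def poly_monom)
    fix g h :: "'a poly"
    assume "g \<in> {g. degree g < degree f}" "h \<in> {g. degree g < degree f}" "f dvd g - h"
    thus "g = h"
      using dvd_imp_degree_le[of f "g - h"] degree_diff_less[of g "degree f" h] by fastforce
  qed (use card in auto)
  hence "degree f \<le> t" using card P \<open>q > 1\<close> by (simp add: N_def q_def)
  moreover have "t \<le> degree f"
  proof -
    \<comment> \<open>Fermat's theorem needs x to be nonzero modulo \<open>f\<close>; otherwise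
      \<open>f\<close> would divide both x^m and x^m - 1.\<close>
    have "\<not> f dvd [:0, 1:]"
    proof
      assume "f dvd [:0, 1:]"
      hence "f dvd [:0, 1:] ^ m" using \<open>m > 0\<close> by (simp add: dvd_power_iff dvd_trans[OF _ dvd_power])
      moreover have "f dvd [:0, 1:] ^ m - 1" by (simp add: dvd_iff)
      ultimately have "f dvd [:0, 1:] ^ m - ([:0, 1:] ^ m - 1)" by (rule dvd_diff)
      thus False using prime by (simp add: prime_elem_def)
    qed
    hence "m dvd q ^ degree f - 1"
      using prime_elem_poly_fermat[OF prime, of "[:0, 1:]"] by (simp only: dvd_iff q_def simp_thms)
    hence "[q ^ degree f = 1] (mod m)" using \<open>q > 1\<close> by (simp add: cong_altdef_nat)
    hence "t dvd degree f" unfolding t_def ord_divides .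
    thus ?thesis using \<open>degree f > 0\<close> by (auto dest: dvd_imp_le)
  qed
  ultimately show ?thesis by (simp add: t_def q_def)
qed

section \<open>Doubling an even cyclotomic index\<close>

lemma pcompose_monom_power: "pcompose (monom 1 k) (monom 1 j) = (monom 1 (j * k) :: 'a::comm_ring_1 poly)"
proof (induction k)
  case 0
  show ?case by (simp add: monom_0)
next
  case (Suc k)
  have "pcompose (monom 1 (Suc k)) (monom 1 j) = monom 1 j * pcompose (monom 1 k) (monom 1 j :: 'a poly)"
    by (simp only: monom_Suc pcompose_pCons) simp
  thus ?case unfolding Suc mult_monom by simp
qed

text \<open>The divisors of \<open>k\<close> account for the factor x^k - 1 of x^(2k) - 1, and
  cancelling it leaves x^k + 1.\<close>

lemma prod_cyclotomic_half:
  assumes "k > 0"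
  shows "(\<Prod>e | e dvd 2 * k \<and> \<not> e dvd k. cyclotomic e) = (monom 1 k + 1 :: 'a::idom poly)"
proof -
  let ?A = "\<Prod>e | e dvd 2 * k \<and> \<not> e dvd k. cyclotomic e :: 'a poly"
  have "monom 1 (2 * k) - 1 = (\<Prod>e | e dvd 2 * k. cyclotomic e :: 'a poly)"
    using assms by (simp add: prod_cyclotomic)
  also have "{e. e dvd 2 * k} = {e. e dvd 2 * k \<and> \<not> e dvd k} \<union> {e. e dvd k}" by auto
  also have "(\<Prod>e\<in>\<dots>. cyclotomic e) = ?A * (monom 1 k - 1 :: 'a poly)"
    using assms by (subst prod.union_disjoint) (auto simp: prod_cyclotomic)
  finally have "?A * (monom 1 k - 1) = (monom 1 k + 1) * (monom 1 k - 1)"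
    by (simp add: algebra_simps mult_monom flip: mult_2)
  moreover have "monom 1 k - 1 \<noteq> (0 :: 'a poly)"
    using assms by (simp add: monom_eq_1_iff)
  ultimately show ?thesis by simp
qed

text \<open>With \<open>m = 2 * k\<close>, the polynomial x^m + 1 is factored twice: directly over
  the divisors of \<open>2 * m\<close> not dividing \<open>m\<close>, and by substituting x^2 into
  the factorization of x^k + 1. The induction hypothesis matches all factors except those for
  \<open>m\<close>, so these agree too.\<close>

lemma cyclotomic_double:
  assumes "even m" "m > 0"
  shows "cyclotomic (2 * m) = (pcompose (cyclotomic m) (monom 1 2) :: 'a::idom poly)"
  using assms
proof (induction m rule: less_induct)
  case (less m)
  then obtain k where m: "m = 2 * k" by auto
  with less have "k > 0" by simp
  define E where "E = {e. e dvd m \<and> \<not> e dvd k}"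
  define A where "A = (\<Prod>e\<in>E - {m}. pcompose (cyclotomic e) (monom 1 2) :: 'a poly)"
  have E: "finite E" "m \<in> E" using \<open>k > 0\<close> by (auto simp: E_def m dest: dvd_imp_le)
  have ev: "even e" if "e \<in> E" for e
    using that coprime_dvd_mult_right_iff[of e 2 k] by (auto simp: E_def m)
  \<comment> \<open>Doubling is a bijection between the index sets of the two factorizations. Both
    contain only even numbers, since an odd divisor of twice a number divides the number
    itself.\<close>
  have "{e. e dvd 2 * m \<and> \<not> e dvd m} = (*) 2 ` E"
  proof (intro equalityI subsetI)
    fix e assume e: "e \<in> {e. e dvd 2 * m \<and> \<not> e dvd m}"
    hence "even e" using coprime_dvd_mult_right_iff[of e 2 m] by auto
    thus "e \<in> (*) 2 ` E" using e by (auto simp: E_def m)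
  qed (auto simp: E_def m)
  hence "monom 1 m + 1 = (\<Prod>e\<in>E. cyclotomic (2 * e) :: 'a poly)"
    using prod_cyclotomic_half[of m, where ?'a = 'a] less.prems
    by (simp add: prod.reindex inj_on_def)
  also have "\<dots> = cyclotomic (2 * m) * A"
  proof -
    have "cyclotomic (2 * e) = (pcompose (cyclotomic e) (monom 1 2) :: 'a poly)"
      if "e \<in> E - {m}" for e
    proof (rule less.IH)
      have "e dvd m" "e \<noteq> m" using that by (auto simp: E_def)
      thus "e < m" "e > 0" using dvd_imp_le[of e m] less.prems by (auto intro!: Nat.gr0I)
      show "even e" using that ev by auto
    qed
    thus ?thesis using E by (simp add: A_def prod.remove[of _ m])
  qed
  finally have 1: "monom 1 m + 1 = cyclotomic (2 * m) * A" .
  have "monom 1 m + 1 = pcompose (monom 1 k + 1 :: 'a poly) (monom 1 2)"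
    by (simp add: pcompose_add pcompose_1 pcompose_monom_power m)
  also have "monom 1 k + 1 = (\<Prod>e\<in>E. cyclotomic e :: 'a poly)"
    using prod_cyclotomic_half[OF \<open>k > 0\<close>, where ?'a = 'a] by (simp add: E_def m)
  also have "pcompose \<dots> (monom 1 2) = pcompose (cyclotomic m) (monom 1 2) * A"
    using E by (simp add: A_def pcompose_prod pcompose_mult prod.remove[of _ m])
  finally have "cyclotomic (2 * m) * A = pcompose (cyclotomic m) (monom 1 2) * A" using 1 by simp
  moreover have "monom 1 m + 1 \<noteq> (0 :: 'a poly)"
  proof
    assume "monom 1 m + 1 = (0 :: 'a poly)"
    from arg_cong[OF this, of "\<lambda>p. coeff p m"] show False using less.prems by simp
  qed
  hence "A \<noteq> 0" using 1 by auto
  ultimately show ?case by simp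
qed

lemma cyclotomic_two_power_mult:
  assumes "even m" "m > 0"
  shows "cyclotomic (2 ^ j * m) = (pcompose (cyclotomic m) (monom 1 (2 ^ j)) :: 'a::idom poly)"
proof (induction j)
  case 0
  thus ?case by (simp add: monom_altdef)
next
  case (Suc j)
  have "cyclotomic (2 ^ Suc j * m) = (cyclotomic (2 * (2 ^ j * m)) :: 'a poly)"
    by (simp add: mult.assoc)
  also have "\<dots> = pcompose (pcompose (cyclotomic m) (monom 1 (2 ^ j))) (monom 1 2)"
    using assms Suc by (simp add: cyclotomic_double)
  also have "\<dots> = pcompose (cyclotomic m) (monom 1 (2 ^ Suc j))"
    by (simp add: pcompose_monom_power flip: pcompose_assoc)
  finally show ?case .
qed

section \<open>Monic irreducible factors\<close>

text \<open>A divisor of least positive degree is irreducible; scaling makes it monic.\<close>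

lemma ex_monic_irreducible_factor:
  fixes P :: "'a::field poly"
  assumes "degree P > 0"
  shows "\<exists>h. h \<in> monic_irreducible_factors P"
proof -
  define R where "R n \<longleftrightarrow> n > 0 \<and> (\<exists>h. h dvd P \<and> degree h = n)" for n
  define n where "n = (LEAST n. R n)"
  have "R (degree P)" unfolding R_def using assms by (intro conjI exI[of _ P]) auto
  hence "R n" unfolding n_def by (rule LeastI)
  then obtain h where h: "h dvd P" "degree h = n" "n > 0" unfolding R_def by blast
  have least: "\<not> R i" if "i < n" for i using not_less_Least[of i R] that by (simp add: n_def)
  have "irreducible h"
  proof (rule irreducibleI)
    show "h \<noteq> 0" using h(2,3) by auto
    thus "\<not> is_unit h" using h(2,3) by (simp add: is_unit_iff_degree)
    fix a b assume ab: "h = a * b"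
    hence nz: "a \<noteq> 0" "b \<noteq> 0" using \<open>h \<noteq> 0\<close> by auto
    hence "degree a + degree b = n" using ab h by (simp add: degree_mult_eq)
    moreover have "a dvd P" "b dvd P" using h(1) unfolding ab by (auto dest: dvd_mult_left dvd_mult_right)
    ultimately have "degree a = 0 \<or> degree b = 0"
      using least[of "degree a"] least[of "degree b"] unfolding R_def
      by (metis add_0_right less_add_same_cancel1 neq0_conv)
    thus "is_unit a \<or> is_unit b" using nz by (simp add: is_unit_iff_degree)
  qed
  moreover define c where "c = inverse (lead_coeff h)"
  have "lead_coeff h \<noteq> 0" using h(2,3) by auto
  hence "c \<noteq> 0" by (simp add: c_def)
  have unit: "is_unit [:c:]" using \<open>c \<noteq> 0\<close> by (simp add: is_unit_const_poly_iff dvd_field_iff)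
  have "smult c h = [:c:] * h" by simp
  ultimately have "irreducible (smult c h)"
    using irreducible_mult_unit_left[OF unit, of h] by simp
  moreover have "lead_coeff (smult c h) = 1" using \<open>lead_coeff h \<noteq> 0\<close> by (simp add: c_def)
  moreover have "smult c h dvd P" using h(1) \<open>c \<noteq> 0\<close> by (simp add: smult_dvd_iff)
  ultimately show ?thesis unfolding monic_irreducible_factors_def by blast
qed

lemma monic_dvd_degree_eq_imp_eq:
  fixes f g :: "'a::field poly"
  assumes "f dvd g" "lead_coeff f = 1" "lead_coeff g = 1" "degree f = degree g"
  shows "f = g"
proof -
  obtain h where h: "g = f * h" using assms(1) by auto
  have "g \<noteq> 0" using assms(3) by auto
  hence "f \<noteq> 0" "h \<noteq> 0" using h by auto
  hence "degree h = 0" using h assms(4) by (simp add: degree_mult_eq)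
  moreover have "lead_coeff h = 1" using h assms(2,3) by (simp add: lead_coeff_mult)
  ultimately have "h = 1" by (metis degree_eq_zeroE lead_coeff_pCons(2) one_pCons)
  thus ?thesis using h by simp
qed

text \<open>An irreducible factor of \<open>H\<close> is also one of \<open>F\<close>, hence has the
  full degree of \<open>H\<close> and equals it. This is how irreducibility is read off from degrees
  alone.\<close>

lemma monic_irreducible_factor_of_min_degree:
  fixes F H :: "'a::field poly"
  assumes "\<And>h. h \<in> monic_irreducible_factors F \<Longrightarrow> degree h = degree H"
    and "H dvd F" "lead_coeff H = 1" "degree H > 0"
  shows "H \<in> monic_irreducible_factors F"
proof -
  obtain h where h: "h \<in> monic_irreducible_factors H"
    using ex_monic_irreducible_factor[OF assms(4)] by auto
  hence hF: "h \<in> monic_irreducible_factors F"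
    using assms(2) by (auto simp: monic_irreducible_factors_def intro: dvd_trans)
  have "h = H"
    using h assms(3) assms(1)[OF hF]
    by (intro monic_dvd_degree_eq_imp_eq) (auto simp: monic_irreducible_factors_def)
  thus ?thesis using hF by simp
qed

text \<open>Composition with \<open>w\<close> is multiplicative, so a prime dividing the composition
  of a product divides that of one factor. Splitting off irreducible factors of \<open>P\<close>
  terminates because a nonzero constant composes to a unit, which \<open>f\<close> cannot
  divide.\<close>

lemma prime_dvd_pcompose_imp_dvd_factor:
  fixes P w f :: "'a::field poly"
  assumes "prime_elem f" "P \<noteq> 0" "f dvd pcompose P w"
  shows "\<exists>h\<in>monic_irreducible_factors P. f dvd pcompose h w"
  using assms(2,3)
proof (induction "degree P" arbitrary: P rule: less_induct)
  case less
  have "degree P > 0"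
  proof (rule Nat.gr0I)
    assume "degree P = 0"
    then obtain c where c: "P = [:c:]" by (metis degree_eq_zeroE)
    with less.prems have "is_unit (pcompose P w)" by (simp add: is_unit_const_poly_iff dvd_field_iff)
    thus False using less.prems(2) assms(1) dvd_unit_imp_unit by (auto simp: prime_elem_def)
  qed
  then obtain h where h: "h \<in> monic_irreducible_factors P"
    using ex_monic_irreducible_factor by blast
  then obtain Q where Q: "P = h * Q" by (auto simp: monic_irreducible_factors_def)
  have nz: "Q \<noteq> 0" "h \<noteq> 0" using Q less.prems(1) by auto
  have "degree h > 0" using h nz
    by (auto simp: monic_irreducible_factors_def irreducible_def is_unit_iff_degree intro!: Nat.gr0I)
  hence "degree Q < degree P" using nz by (simp add: Q degree_mult_eq)
  have "f dvd pcompose h w \<or> f dvd pcompose Q w"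
    using less.prems(2) assms(1) by (simp add: Q pcompose_mult prime_elem_dvd_mult_iff)
  thus ?case
  proof
    assume "f dvd pcompose Q w"
    from less.hyps[OF \<open>degree Q < degree P\<close> nz(1) this]
    obtain h' where "h' \<in> monic_irreducible_factors Q" "f dvd pcompose h' w" by blast
    thus ?thesis by (auto simp: Q monic_irreducible_factors_def)
  qed (use h in blast)
qed

lemma pcompose_dvd_pcompose: "p dvd q \<Longrightarrow> pcompose p w dvd pcompose q w"
  for p q w :: "'a::comm_ring_1 poly"
  by (auto simp: pcompose_mult elim!: dvdE)

section \<open>The order of q modulo 2^n r\<close>

text \<open>The part \<open>r\<close> of the modulus makes the order a multiple of \<open>d\<close>.
  The part \<open>2 ^ n\<close> determines the remaining multiplier by lifting the exponent for
  \<open>q ^ d\<close>, which is 1 plus \<open>2 ^ K\<close> times an odd number.\<close>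

lemma ord_two_power_mult:
  fixes q r d K n :: nat
  assumes "odd r" "coprime r q" "d = ord r q" "q > 1"
    and "K = multiplicity 2 (q ^ d - 1)" "K \<ge> 2"
  shows "ord (2 ^ n * r) q = d * 2 ^ (n - K)"
proof (rule dvd_antisym)
  have "d > 0" using assms(2,3) by simp
  hence "q ^ d > 1" using assms(4) by (simp add: one_less_power del: One_nat_def)
  then obtain c where c: "q ^ d - 1 = 2 ^ K * c" "odd c"
    using multiplicity_decompose'[of "q ^ d - 1" 2] assms(5) by auto
  hence qd: "q ^ d = 1 + 2 ^ K * c" using \<open>q ^ d > 1\<close> by simp
  note iff = two_power_cong_iff[OF qd c(2) assms(6)]
  show "ord (2 ^ n * r) q dvd d * 2 ^ (n - K)"
  proof -
    \<comment> \<open>Under truncated subtraction \<open>K + (n - K)\<close> is the maximum of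
      \<open>K\<close> and \<open>n\<close>, so one congruence serves both cases.\<close>
    have "[(q ^ d) ^ 2 ^ (n - K) = 1] (mod 2 ^ (K + (n - K)))" using iff[of "2 ^ (n - K)" "n - K"] by simp
    hence "[(q ^ d) ^ 2 ^ (n - K) = 1] (mod 2 ^ n)"
      by (rule cong_dvd_modulus_nat) (simp add: le_imp_power_dvd)
    moreover have "[(q ^ d) ^ 2 ^ (n - K) = 1 ^ 2 ^ (n - K)] (mod r)"
      unfolding assms(3) by (intro cong_pow ord)
    ultimately have "[(q ^ d) ^ 2 ^ (n - K) = 1] (mod 2 ^ n * r)"
      using assms(1) by (intro coprime_cong_mult_nat) auto
    thus ?thesis by (simp add: power_mult flip: ord_divides)
  qed
  define t where "t = ord (2 ^ n * r) q"
  have t: "[q ^ t = 1] (mod 2 ^ n * r)" unfolding t_def by (rule ord)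
  hence "d dvd t" unfolding assms(3) ord_divides[symmetric] by (rule cong_dvd_modulus_nat) simp
  then obtain u where u: "t = d * u" by auto
  have "2 ^ (n - K) dvd u"
  proof (cases "n \<le> K")
    case False
    have "[(q ^ d) ^ u = 1] (mod 2 ^ n)"
      using t unfolding u power_mult by (rule cong_dvd_modulus_nat) simp
    thus ?thesis using iff[of u "n - K"] False by simp
  qed simp
  thus "d * 2 ^ (n - K) dvd ord (2 ^ n * r) q" by (simp add: u flip: t_def)
qed

text \<open>Supplies the bound under which lifting the exponent at 2 works. For even
  \<open>d\<close>, the square of an odd number is 1 modulo 4; for odd \<open>d\<close>, the
  congruence assumed of \<open>q\<close> gives it.\<close>

lemma two_le_multiplicity:
  fixes q d :: nat
  assumes "odd q" "q > 1" "d > 0" "odd d \<longrightarrow> [q = 1] (mod 4)"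
  shows "multiplicity 2 (q ^ d - 1) \<ge> 2"
proof (rule multiplicity_geI)
  have "q ^ d > 1" using assms(2,3) by (simp add: one_less_power del: One_nat_def)
  thus "q ^ d - 1 \<noteq> 0" by simp
  have "[q ^ d = 1] (mod 4)"
  proof (cases "odd d")
    case True
    thus ?thesis using assms(4) cong_pow[of q 1 4 d] by simp
  next
    case False
    then obtain e where e: "d = 2 * e" by auto
    obtain k where "q = 2 * k + 1" using assms(1) by (auto elim: oddE)
    hence "q ^ 2 = 1 + 4 * (k ^ 2 + k)" by (simp add: power2_eq_square algebra_simps)
    hence "[q ^ 2 = 1] (mod 4)" by (simp add: cong_def)
    thus ?thesis using cong_pow[of "q ^ 2" 1 4 e] by (simp add: e power_mult)
  qed
  thus "2 ^ 2 dvd q ^ d - 1" using \<open>q ^ d > 1\<close> by (simp add: cong_altdef_nat)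
qed simp

section \<open>Degrees, splitting and lifting of the factors\<close>

theorem theorem3p8:
  fixes p s q r d K :: nat
  assumes "prime p" and "odd p" and "s \<ge> 1" and "q = p ^ s"
    and "CARD('a::{field,finite}) = q"
    and "odd r" and "r \<ge> 3" and "coprime r q"
    and "d = ord r q"
    and "odd d \<longrightarrow> [q = 1] (mod 4)"
    and "K = multiplicity 2 (q ^ d - 1)"
  shows "(\<forall>n\<le>K. \<forall>h::'a poly. h \<in> monic_irreducible_factors (cyclotomic (2 ^ n * r)) \<longrightarrow>
            degree h = d)
       \<and> (\<forall>n. 0 < n \<and> n < K \<longrightarrow>
            (\<forall>h::'a poly. h \<in> monic_irreducible_factors (cyclotomic (2 ^ n * r)) \<longrightarrow>
              (\<exists>f g. f \<noteq> g
                \<and> f \<in> monic_irreducible_factors (cyclotomic (2 ^ (n + 1) * r))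
                \<and> g \<in> monic_irreducible_factors (cyclotomic (2 ^ (n + 1) * r))
                \<and> degree f = d \<and> degree g = d
                \<and> pcompose h (monom 1 2) = f * g)))
       \<and> (\<forall>n>K.
            (\<forall>h::'a poly. h \<in> monic_irreducible_factors (cyclotomic (2 ^ K * r)) \<longrightarrow>
              irreducible (pcompose h (monom 1 (2 ^ (n - K)))))
            \<and> (monic_irreducible_factors (cyclotomic (2 ^ n * r)) :: 'a poly set)
                = (\<lambda>h. pcompose h (monom 1 (2 ^ (n - K))))
                    ` monic_irreducible_factors (cyclotomic (2 ^ K * r)))"
proof -
  define C where "C n = (cyclotomic (2 ^ n * r) :: 'a poly)" for n
  have "q > 1" using assms(1,3,4) prime_gt_1_nat by (simp add: one_less_power del: One_nat_def)
  have "d > 0" using assms by simp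
  have "K \<ge> 2"
    unfolding assms(11) using assms \<open>q > 1\<close> \<open>d > 0\<close> by (intro two_le_multiplicity) auto
  have cop: "coprime (2 ^ n * r) q" for n using assms by simp
  \<comment> \<open>Truncated subtraction makes this \<open>d\<close> whenever
    \<open>n \<le> K\<close>, so the formula covers every \<open>n\<close>.\<close>
  have deg: "degree h = d * 2 ^ (n - K)" if "h \<in> monic_irreducible_factors (C n)" for n h
  proof -
    have "degree h = ord (2 ^ n * r) CARD('a)"
      using that cop[of n] assms(4,5)
      by (intro degree_irreducible_factor_cyclotomic[OF assms(1)])
        (auto simp: C_def monic_irreducible_factors_def)
    thus ?thesis
      using ord_two_power_mult[OF assms(6,8,9) \<open>q > 1\<close> assms(11) \<open>K \<ge> 2\<close>] assms(5) by simp
  qed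
  \<comment> \<open>Positivity of \<open>n\<close> makes the index even, as the doubling identity
    requires.\<close>
  have C: "pcompose (C n) (monom 1 (2 ^ j)) = C (n + j)" if "n > 0" for n j
  proof -
    have "cyclotomic (2 ^ j * (2 ^ n * r)) = pcompose (C n) (monom 1 (2 ^ j))"
      unfolding C_def using that assms(7) by (intro cyclotomic_two_power_mult) auto
    thus ?thesis by (simp add: C_def power_add mult_ac)
  qed
  have monic: "lead_coeff (pcompose h (monom 1 (2 ^ j))) = 1"
    if "h \<in> monic_irreducible_factors (C n)" for h n j
    using that lead_coeff_comp[of "monom 1 (2 ^ j)" h]
    by (simp add: monic_irreducible_factors_def degree_monom_eq)
  have degc: "degree (pcompose h (monom 1 (2 ^ j))) = degree h * 2 ^ j" for h :: "'a poly" and j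
    by (simp add: degree_pcompose degree_monom_eq)

  \<comment> \<open>The composed polynomial has degree \<open>2 * d\<close>, but
    \<open>n + 1 \<le> K\<close> forces every irreducible factor to have degree \<open>d\<close>.
    One factor is chosen, and its cofactor has degree \<open>d\<close>, hence is irreducible
    too.\<close>
  have split: "\<exists>f g. f \<noteq> g \<and> f \<in> monic_irreducible_factors (C (n + 1))
      \<and> g \<in> monic_irreducible_factors (C (n + 1))
      \<and> degree f = d \<and> degree g = d \<and> pcompose h (monom 1 2) = f * g"
    if n: "0 < n" "n < K" and h: "h \<in> monic_irreducible_factors (C n)" for n h
  proof -
    define H where "H = pcompose h (monom 1 2)"
    have H: "lead_coeff H = 1" "degree H = 2 * d"
      using monic[OF h, of 1] degc[of h 1] deg[OF h] n by (simp_all add: H_def)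
    have HC: "H dvd C (n + 1)"
      using h C[OF n(1), of 1] pcompose_dvd_pcompose[of h "C n" "monom 1 2"]
      by (simp add: H_def monic_irreducible_factors_def)
    have deg': "degree f = d" if "f \<in> monic_irreducible_factors (C (n + 1))" for f
      using deg[OF that] n by simp
    obtain f where f: "f \<in> monic_irreducible_factors H"
      using ex_monic_irreducible_factor[of H] H \<open>d > 0\<close> by auto
    hence fC: "f \<in> monic_irreducible_factors (C (n + 1))"
      using HC by (auto simp: monic_irreducible_factors_def intro: dvd_trans)
    obtain g where g: "H = f * g" using f by (auto simp: monic_irreducible_factors_def)
    have lg: "lead_coeff g = 1"
      using H(1) f unfolding g lead_coeff_mult by (simp add: monic_irreducible_factors_def)
    have "H \<noteq> 0" using H \<open>d > 0\<close> by auto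
    hence dg: "degree g = d"
      using H(2) deg'[OF fC] unfolding g by (auto simp: degree_mult_eq)
    have gC: "g \<in> monic_irreducible_factors (C (n + 1))"
      using dg lg deg' HC \<open>d > 0\<close>
      by (intro monic_irreducible_factor_of_min_degree) (auto simp: g dest: dvd_mult_right)
    \<comment> \<open>Equal factors would give a square dividing x^m - 1 for
      \<open>m = 2 ^ (n + 1) * r\<close>, which is prime to \<open>p\<close>.\<close>
    have "f \<noteq> g"
    proof
      assume "f = g"
      let ?m = "2 ^ (n + 1) * r"
      have "?m > 0" using assms(7) by simp
      hence "f * f dvd [:0, 1:] ^ ?m - 1"
        using HC cyclotomic_dvd[of ?m, where ?'a = 'a] g \<open>f = g\<close>
        by (auto simp: C_def intro: dvd_trans)
      moreover have "of_nat ?m \<noteq> (0 :: 'a)"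
      proof
        assume "of_nat ?m = (0 :: 'a)"
        hence "p dvd ?m"
          using CHAR_finite_field[OF assms(1), where ?'a = 'a] assms(4,5)
          by (simp only: of_nat_eq_0_iff_char_dvd)
        moreover have "p dvd q" using assms(3,4) by simp
        ultimately show False
          using cop[of "n + 1"] assms(1) coprime_common_divisor not_prime_unit by blast
      qed
      moreover have "prime_elem f"
        using f by (simp add: monic_irreducible_factors_def field_poly_irreducible_imp_prime)
      ultimately show False using not_square_dvd_X_power_minus_one by blast
    qed
    thus ?thesis using fC gC deg'[OF fC] dg g unfolding H_def by blast
  qed

  \<comment> \<open>The composed polynomial already has degree \<open>d * 2 ^ (n - K)\<close>, the
    common degree of all irreducible factors of \<open>C n\<close>, so it cannot split.\<close>
  have lift: "pcompose h (monom 1 (2 ^ (n - K))) \<in> monic_irreducible_factors (C n)"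
    if n: "n > K" and h: "h \<in> monic_irreducible_factors (C K)" for n h
  proof (rule monic_irreducible_factor_of_min_degree)
    have dh: "degree h = d" using deg[OF h] by simp
    thus "degree (pcompose h (monom 1 (2 ^ (n - K)))) > 0" using \<open>d > 0\<close> by (simp add: degc)
    show "degree f = degree (pcompose h (monom 1 (2 ^ (n - K))))"
      if "f \<in> monic_irreducible_factors (C n)" for f
      using deg[OF that] dh by (simp add: degc)
    show "pcompose h (monom 1 (2 ^ (n - K))) dvd C n"
      using h pcompose_dvd_pcompose[of h "C K" "monom 1 (2 ^ (n - K))"] C[of K "n - K"] n \<open>K \<ge> 2\<close>
      by (simp add: monic_irreducible_factors_def)
    show "lead_coeff (pcompose h (monom 1 (2 ^ (n - K)))) = 1" using h by (rule monic)
  qed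

  \<comment> \<open>A factor of \<open>C n\<close> divides the composition of some factor of
    \<open>C K\<close>; both are monic of the same degree, hence equal.\<close>
  have surj: "f \<in> (\<lambda>h. pcompose h (monom 1 (2 ^ (n - K)))) ` monic_irreducible_factors (C K)"
    if n: "n > K" and f: "f \<in> monic_irreducible_factors (C n)" for n f
  proof -
    have "prime_elem f" "f dvd pcompose (C K) (monom 1 (2 ^ (n - K)))"
      using f C[of K "n - K"] n \<open>K \<ge> 2\<close>
      by (simp_all add: monic_irreducible_factors_def field_poly_irreducible_imp_prime)
    moreover have "C K \<noteq> 0"
      unfolding C_def using lead_coeff_cyclotomic[of "2 ^ K * r", where ?'a = 'a] by auto
    ultimately obtain h where h: "h \<in> monic_irreducible_factors (C K)"
        "f dvd pcompose h (monom 1 (2 ^ (n - K)))"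
      using prime_dvd_pcompose_imp_dvd_factor by blast
    have "f = pcompose h (monom 1 (2 ^ (n - K)))"
    proof (rule monic_dvd_degree_eq_imp_eq[OF h(2) _ monic[OF h(1)]])
      show "lead_coeff f = 1" using f by (simp add: monic_irreducible_factors_def)
      show "degree f = degree (pcompose h (monom 1 (2 ^ (n - K))))"
        using deg[OF f] deg[OF h(1)] by (simp add: degc)
    qed
    thus ?thesis using h(1) by blast
  qed

  show ?thesis
    unfolding C_def[symmetric]
  proof (intro conjI allI impI)
    show "degree h = d" if "n \<le> K" "h \<in> monic_irreducible_factors (C n)" for n h
      using deg[OF that(2)] that(1) by simp
    show "irreducible (pcompose h (monom 1 (2 ^ (n - K))))"
      if "n > K" "h \<in> monic_irreducible_factors (C K)" for n h
      using lift[OF that] by (simp add: monic_irreducible_factors_def)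
    show "monic_irreducible_factors (C n) =
        (\<lambda>h. pcompose h (monom 1 (2 ^ (n - K)))) ` monic_irreducible_factors (C K)"
      if "n > K" for n
      using lift[OF that] surj[OF that] by blast
  qed (use split in blast)
qed

end
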